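(* Let $\beta$ be hyperbolic. There exist a natural number $k$, a $1\times k$ vector $W$, and three $k\times k$ matrices $M_{-1},M_0,M_1$ such that for any $x\in X(\beta)$ and any $c_1\cdots c_n\in\{-1,0,1\}^n$ with $x=\sum_{i=1}^n c_i\beta^{n-i}$, $$\mu(x)=\frac{1}{\lambda^n}\left(WM_{c_1}\cdots M_{c_n}\right)_1,$$ where $(WM_{c_1}\cdots M_{c_n})_1$ denotes the first entry of the row vector $WM_{c_1}\cdots M_{c_n}$.
   Context: A real number $\beta>1$ is called hyperbolic if it is an algebraic integer, is a root of a nonzero polynomial with coefficients in $\{-1,0,1\}$, and has no Galois conjugate of absolute value one. $X(\beta):=\left\{\sum_{i=1}^n c_i\beta^{n-i}: n\in\mathbb N,\ c_i\in\{-1,0,1\}\right\}$. For $x\in\mathbb R$ and $n\in\mathbb N$, $$\mathcal N_n(x)=\#\left\{(a_1,\dots,a_n,b_1,\dots,b_n)\in\{0,1\}^{2n}:\ \sum_{i=1}^n (a_i-b_i)\beta^{n-i}=x\right\}.$$ $\lambda>1$ denotes the (unique) real number such that for every $x\in X(\beta)$ the limit $\mu(x):=\lim_{n\to\infty}\lambda^{-n}\mathcal N_n(x)$ exists and lies in $(0,\infty)$ (for hyperbolic $\beta$ such a $\lambda$ exists). *)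

theory Defs
  imports
    Complex_Main
    "HOL-Library.FuncSet"
    "HOL-Computational_Algebra.Computational_Algebra"
    "Jordan_Normal_Form.Matrix"
begin

definition is_min_poly :: "rat poly \<Rightarrow> complex \<Rightarrow> bool" where
  "is_min_poly p x \<longleftrightarrow>
     lead_coeff p = 1 \<and> irreducible p \<and> poly (map_poly of_rat p) x = 0"

definition galois_conjugate :: "complex \<Rightarrow> complex \<Rightarrow> bool" where
  "galois_conjugate x z \<longleftrightarrow> (\<exists>p. is_min_poly p x \<and> poly (map_poly of_rat p) z = 0)"

definition hyperbolic :: "real \<Rightarrow> bool" where
  "hyperbolic \<beta> \<longleftrightarrow>
     \<beta> > 1 \<and>
     algebraic_int \<beta> \<and>
     (\<exists>p :: int poly. p \<noteq> 0 \<and> (\<forall>i. coeff p i \<in> {-1, 0, 1}) \<and> poly (map_poly of_int p) \<beta> = 0) \<and>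
     (\<forall>z. galois_conjugate (of_real \<beta>) z \<longrightarrow> cmod z \<noteq> 1)"

definition beta_sum :: "real \<Rightarrow> nat \<Rightarrow> (nat \<Rightarrow> int) \<Rightarrow> real" where
  "beta_sum \<beta> n c = (\<Sum>i = 1..n. of_int (c i) * \<beta> ^ (n - i))"

definition X :: "real \<Rightarrow> real set" where
  "X \<beta> = {beta_sum \<beta> n c | n c. \<forall>i\<in>{1..n}. c i \<in> {-1, 0, 1}}"

(* The extensional function space makes each 0-1 word of length n a single function,
   so that card counts words. *)
definition \<N> :: "real \<Rightarrow> nat \<Rightarrow> real \<Rightarrow> nat" where
  "\<N> \<beta> n x = card {(a, b). a \<in> {1..n} \<rightarrow>\<^sub>E {0, 1} \<and> b \<in> {1..n} \<rightarrow>\<^sub>E {0, 1} \<and>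
                         beta_sum \<beta> n (\<lambda>i. a i - b i) = x}"

(* The unique l with this property is the constant written lambda in the definition of mu. *)
definition growth_rate :: "real \<Rightarrow> real \<Rightarrow> bool" where
  "growth_rate \<beta> l \<longleftrightarrow>
     l > 1 \<and> (\<forall>x\<in>X \<beta>. \<exists>m>0. (\<lambda>n. real (\<N> \<beta> n x) / l ^ n) \<longlonglongrightarrow> m)"

definition \<mu> :: "real \<Rightarrow> real \<Rightarrow> real \<Rightarrow> real" where
  "\<mu> \<beta> l x = lim (\<lambda>n. real (\<N> \<beta> n x) / l ^ n)"

definition row_product :: "real mat \<Rightarrow> (int \<Rightarrow> real mat) \<Rightarrow> nat \<Rightarrow> (nat \<Rightarrow> int) \<Rightarrow> real mat" where
  "row_product W M n c = foldl (\<lambda>V i. V * M (c i)) W [1..<Suc n]"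

end

theory Submission
  imports Defs "Jordan_Normal_Form.Char_Poly"
begin

text \<open>
  Splitting off the last letter of a word turns the definition of \<open>\<N>\<close> into a recursion: a pair of
  words of length \<open>n + 1\<close> that ends in \<open>(e, f)\<close> represents \<open>y\<close> exactly if its initial part represents
  \<open>(y - (e - f)) / \<beta>\<close>. In the limit this gives
  \<open>\<lambda> * \<mu>(y) = (\<Sum>e f. \<mu>((y - (e - f)) / \<beta>))\<close>, where \<open>\<mu>\<close> vanishes off \<open>X(\<beta>)\<close> because the counts do
  (lemma \<open>mu_recursion\<close>).

  Appending a letter \<open>d\<close> to a word of value \<open>x\<close> gives the value \<open>\<beta> x + d\<close>. By the recursion at the point
  \<open>\<beta> x + d + t\<close>, the number \<open>\<lambda> * \<mu>(\<beta> x + d + t)\<close> is the sum of the values \<open>\<mu>(x + s)\<close> over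
  \<open>s = (t + d - (e - f)) / \<beta>\<close>. The coefficients of this linear relation depend on \<open>d\<close> but not on \<open>x\<close>. So if
  a finite set \<open>T\<close> of offsets contains \<open>0\<close> and every such \<open>s\<close> for \<open>t \<in> T\<close>, then the row vectors
  \<open>(\<mu>(x + t))\<close> indexed by \<open>t \<in> T\<close> satisfy the required matrix relation, and \<open>W\<close> is the vector at
  \<open>x = 0\<close>, the value of the empty word. Only those \<open>s\<close> have to be in \<open>T\<close> for which \<open>\<mu>(x + s)\<close> can be
  nonzero, which forces \<open>x + s\<close>, like \<open>x\<close>, to lie in \<open>X(\<beta>)\<close>, and then \<open>s\<close> is an integer polynomial in
  \<open>\<beta>\<close> with coefficients of absolute value at most 2.

  The set \<open>T\<close> consists of the elements \<open>q(\<beta>)\<close> of \<open>\<int>[\<beta>]\<close> with \<open>|q(z)| \<le> 2 / ||z| - 1|\<close> for every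
  conjugate \<open>z\<close> of \<open>\<beta>\<close>. It has the closure property (lemma \<open>offsets_step\<close>) for two different reasons.
  At a conjugate inside the unit circle the bound comes from the geometric series and the bounded
  coefficients. At a conjugate outside it, the bound is preserved by the contraction
  \<open>w \<mapsto> (w + u) / z\<close> with \<open>|u| \<le> 2\<close>. Hyperbolicity says that there is no third case.

  Finally \<open>T\<close> is finite because in \<open>\<int>[\<beta>]\<close> only finitely many elements have all their conjugates below
  given bounds (theorem \<open>finite_bounded_conjugates\<close>).
\<close>

(* Without this, smult would denote the scalar multiplication of abstract modules. *)
hide_const (open) Module.smult

section \<open>Values of integer and rational polynomials\<close>

abbreviation ipoly :: "int poly \<Rightarrow> 'a::comm_ring_1 \<Rightarrow> 'a" where
  "ipoly q x \<equiv> poly (map_poly of_int q) x"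

abbreviation rpoly :: "rat poly \<Rightarrow> 'a::field_char_0 \<Rightarrow> 'a" where
  "rpoly q x \<equiv> poly (map_poly of_rat q) x"

interpretation rat_poly: map_poly_idom_hom "of_rat :: rat \<Rightarrow> complex" ..

lemma rpoly_of_int_poly: "rpoly (map_poly of_int q) x = ipoly q x"
  by (simp add: map_poly_map_poly o_def)

lemma ipoly_pCons: "ipoly (pCons a q) x = of_int a + x * ipoly q x"
  by (simp add: of_int_hom.map_poly_pCons_hom)

lemma ipoly_of_real: "ipoly q (complex_of_real x) = of_real (ipoly q x)"
  by (induction q) (simp_all add: ipoly_pCons)

lemma cmod_of_rat: "cmod (of_rat a) = \<bar>of_rat a\<bar>"
proof -
  have "(of_rat a :: complex) = of_real (of_rat a)"
    by (cases a) (simp add: of_rat_rat)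
  then show ?thesis
    by (simp only: norm_of_real)
qed

section \<open>Minimal polynomials\<close>

text \<open>
  The rational polynomials vanishing at \<open>z\<close> form an ideal, and any nonzero member of least degree
  divides all of them, by division with remainder.
\<close>

lemma vanishing_rat_polys_generator:
  fixes z :: complex
  assumes "f \<noteq> 0" "rpoly f z = 0"
  obtains p where "p \<noteq> 0" "rpoly p z = 0" "\<not> is_unit p" "\<And>q. rpoly q z = 0 \<Longrightarrow> p dvd q"
proof -
  obtain p where p: "p \<noteq> 0" "rpoly p z = 0"
    and least: "\<And>q. q \<noteq> 0 \<Longrightarrow> rpoly q z = 0 \<Longrightarrow> degree p \<le> degree q"
    using ex_has_least_nat[of "\<lambda>q. q \<noteq> 0 \<and> rpoly q z = 0" f degree] assms by blast
  have "p dvd q" if "rpoly q z = 0" for q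
  proof -
    obtain g r where g: "q = g * p + r" and r: "r = q mod p"
      by (metis div_mult_mod_eq)
    have "rpoly r z = 0"
      using that p by (simp add: g rat_poly.hom_add rat_poly.hom_mult)
    moreover have "r = 0 \<or> degree r < degree p"
      using degree_mod_less p(1) by (simp only: r)
    ultimately have "r = 0"
      using least[of r] by linarith
    then show ?thesis
      by (simp add: g)
  qed
  moreover have "\<not> is_unit p"
  proof
    assume "is_unit p"
    then obtain c where "p = [:c:]"
      using p(1) by (metis degree_eq_zeroE is_unit_iff_degree)
    then show False
      using p by (simp add: map_poly_pCons)
  qed
  ultimately show thesis
    using that p by blast
qed

text \<open>
  The generator of the ideal of polynomials vanishing at the common root divides both \<open>p\<close> and \<open>q\<close>;
  being a non-unit, it is an associate of \<open>p\<close>.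
\<close>

lemma irreducible_rat_poly_dvd_if_common_root:
  fixes p q :: "rat poly" and z :: complex
  assumes "irreducible p" "rpoly p z = 0" "rpoly q z = 0"
  shows "p dvd q"
proof -
  have "p \<noteq> 0"
    using assms(1) by (auto simp: irreducible_def)
  then obtain r where "\<not> is_unit r" "r dvd p" "r dvd q"
    using vanishing_rat_polys_generator[of p z] assms(2,3) by metis
  then have "p dvd r"
    using assms(1) by (auto simp: irreducible_altdef)
  then show ?thesis
    using \<open>r dvd q\<close> by (rule dvd_trans)
qed

lemma algebraic_int_min_poly:
  fixes z :: complex
  assumes "algebraic_int z"
  obtains p where "is_min_poly p z"
proof -
  obtain q where q: "ipoly q z = 0" "lead_coeff q = 1"
    using assms unfolding algebraic_int_altdef_ipoly by blast
  then have "coeff (map_poly of_int q :: rat poly) (degree q) \<noteq> 0"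
    by simp
  then have "(map_poly of_int q :: rat poly) \<noteq> 0"
    by (metis coeff_0)
  then obtain p where p: "p \<noteq> 0" "rpoly p z = 0" "\<not> is_unit p"
    and gen: "\<And>q. rpoly q z = 0 \<Longrightarrow> p dvd q"
    using vanishing_rat_polys_generator[of "map_poly of_int q" z] q(1)
    by (metis rpoly_of_int_poly)
  have irr: "irreducible p"
  proof (rule irreducibleI)
    fix a b assume ab: "p = a * b"
    then have nz: "a \<noteq> 0" "b \<noteq> 0" and "rpoly a z * rpoly b z = 0"
      using p by (auto simp: rat_poly.hom_mult)
    then have "p dvd a \<or> p dvd b"
      using gen by auto
    then have "degree a + degree b \<le> degree a \<or> degree a + degree b \<le> degree b"
      using nz by (metis ab degree_mult_eq dvd_imp_degree_le)
    then show "is_unit a \<or> is_unit b"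
      using nz by (auto simp: is_unit_iff_degree)
  qed (use p in auto)
  define c where "c = inverse (lead_coeff p)"
  have "c \<noteq> 0"
    using p by (simp add: c_def)
  then have "irreducible ([:c:] * p)"
    using irr by (subst irreducible_mult_unit_left) (auto simp: is_unit_const_poly_iff)
  then have "irreducible (smult c p)" "lead_coeff (smult c p) = 1" "rpoly (smult c p) z = 0"
    using p by (simp_all add: c_def of_rat_hom.map_poly_hom_smult)
  then show thesis
    by (intro that[of "smult c p"]) (simp_all add: is_min_poly_def)
qed

text \<open>
  A double root would be shared with the derivative, which \<open>p\<close> would then have to divide in spite of
  its smaller degree.
\<close>

lemma card_roots_irreducible_rat_poly:
  fixes p :: "rat poly"
  assumes "irreducible p"
  shows "card {z :: complex. rpoly p z = 0} = degree p"
proof -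
  let ?p = "map_poly of_rat p :: complex poly"
  have p: "p \<noteq> 0" "degree p > 0"
    using assms by (auto simp: irreducible_def is_unit_iff_degree)
  have "rsquarefree ?p"
    unfolding rsquarefree_roots
  proof (intro allI notI, elim conjE)
    fix z assume "poly ?p z = 0" "poly (pderiv ?p) z = 0"
    then have "p dvd pderiv p"
      using assms irreducible_rat_poly_dvd_if_common_root[of p z "pderiv p"]
      by (simp add: of_rat_hom.map_poly_pderiv)
    then have "degree p \<le> degree (pderiv p)"
      using p by (intro dvd_imp_degree_le) (auto simp: pderiv_eq_0_iff)
    then show False
      using p by (simp add: degree_pderiv)
  qed
  then have "smult (lead_coeff ?p) (\<Prod>z | poly ?p z = 0. [:-z, 1:]) = ?p"
    by (rule complex_poly_decompose_rsquarefree)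
  then have "degree ?p = degree (smult (lead_coeff ?p) (\<Prod>z | poly ?p z = 0. [:-z, 1:]))"
    by (rule arg_cong[OF sym])
  also have "\<dots> = degree (\<Prod>z | poly ?p z = 0. [:-z, 1:])"
    using p by simp
  also have "\<dots> = card {z. poly ?p z = 0}"
    by (subst degree_prod_sum_eq) auto
  finally show ?thesis by simp
qed

section \<open>Finitely many algebraic integers with bounded conjugates\<close>

text \<open>
  The polynomials \<open>L z\<close> depend only on the nodes. This is what bounds the coefficients of a
  polynomial of small degree in terms of its values on \<open>A\<close>.
\<close>

lemma lagrange_interpolation:
  fixes A :: "'a :: field set"
  assumes "finite A"
  obtains L :: "'a \<Rightarrow> 'a poly"
  where "\<And>r. degree r < card A \<Longrightarrow> r = (\<Sum>z\<in>A. smult (poly r z) (L z))"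
proof -
  define L where "L z = (\<Prod>w\<in>A-{z}. smult (inverse (z - w)) [:-w, 1:])" for z
  have L: "poly (L z) x = (if x = z then 1 else 0)" if "z \<in> A" "x \<in> A" for z x
  proof (cases "x = z")
    case True
    have "poly (smult (inverse (z - w)) [:-w, 1:]) z = 1" if "w \<in> A - {z}" for w
    proof -
      have "poly (smult (inverse (z - w)) [:-w, 1:]) z = inverse (z - w) * (z - w)"
        by (simp add: algebra_simps)
      also have "\<dots> = 1"
        using that by (intro left_inverse) auto
      finally show ?thesis .
    qed
    then have "poly (L z) z = 1"
      unfolding L_def poly_prod by (intro prod.neutral) blast
    with True show ?thesis by simp
  next
    case False
    then have "\<exists>w\<in>A-{z}. poly (smult (inverse (z - w)) [:-w, 1:]) x = 0"
      using that by (intro bexI[of _ x]) auto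
    then have "poly (L z) x = 0"
      unfolding L_def poly_prod using assms by (simp only: prod_zero finite_Diff)
    with False show ?thesis by simp
  qed
  have deg: "degree (L z) < card A" if "z \<in> A" for z
  proof -
    have "degree (L z) \<le> (\<Sum>w\<in>A-{z}. degree (smult (inverse (z - w)) [:-w, 1:]))"
      unfolding L_def by (rule order_trans[OF degree_prod_sum_le]) (use assms in \<open>auto simp: o_def\<close>)
    also have "\<dots> \<le> (\<Sum>w\<in>A-{z}. 1)"
      by (intro sum_mono) auto
    also have "\<dots> < card A"
      using card_Diff1_less[OF assms that] by simp
    finally show ?thesis .
  qed
  have "r = (\<Sum>z\<in>A. smult (poly r z) (L z))" if "degree r < card A" for r
  proof (rule poly_eqI_degree[where A = A])
    fix x assume "x \<in> A"
    then have "poly r x = (\<Sum>z\<in>A. if z = x then poly r x else 0)"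
      using assms by simp
    also have "\<dots> = (\<Sum>z\<in>A. poly r z * poly (L z) x)"
      using L \<open>x \<in> A\<close> by (intro sum.cong) auto
    finally show "poly r x = poly (\<Sum>z\<in>A. smult (poly r z) (L z)) x"
      by (simp add: poly_sum)
  next
    show "degree (\<Sum>z\<in>A. smult (poly r z) (L z)) < card A"
      using deg that by (intro degree_sum_less) (auto intro: le_less_trans[OF degree_smult_le])
  qed (use that in auto)
  then show thesis
    using that by blast
qed

lemma common_denominator:
  fixes A :: "rat set"
  assumes "finite A"
  obtains K :: int where "K > 0" "\<And>a. a \<in> A \<Longrightarrow> of_int K * a \<in> \<int>"
  using assms
proof (induction arbitrary: thesis)
  case empty
  show ?case by (rule empty[of 1]) auto
next
  case (insert x A)
  obtain K where K: "K > 0" "\<And>a. a \<in> A \<Longrightarrow> of_int K * a \<in> \<int>"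
    using insert.IH by blast
  obtain n d where x: "x = of_int n / of_int d" "d > 0"
    by (metis quotient_of_denom_pos quotient_of_div surj_pair)
  show ?case
  proof (rule insert.prems[of "K * d"])
    fix a assume "a \<in> insert x A"
    then show "of_int (K * d) * a \<in> \<int>"
    proof
      assume "a \<in> A"
      then have "of_int d * (of_int K * a) \<in> \<int>"
        by (rule Ints_mult[OF Ints_of_int K(2)])
      then show ?thesis by (simp add: mult_ac)
    qed (use x in simp)
  qed (use K x in simp)
qed

text \<open>
  A denominator \<open>K\<close> common to the remainders of \<open>1, x, \<dots>, x^(deg P - 1)\<close> works for all integer
  polynomials, since the monic relation \<open>P \<equiv> 0\<close> writes the remainder of every higher power as an
  integer combination of the preceding ones. With \<open>p\<close> the minimal polynomial of an algebraic integer, a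
  root of \<open>P\<close>, this is enough integrality to avoid the Gauss lemma (which gives \<open>K = 1\<close>).
\<close>

lemma integer_poly_mod_bounded_denominator:
  fixes p :: "rat poly" and P :: "int poly"
  assumes monic: "lead_coeff P = 1" and dvd: "p dvd map_poly of_int P"
  obtains K :: int where "K > 0"
    "\<And>q :: int poly. \<And>j. of_int K * coeff (map_poly of_int q mod p) j \<in> \<int>"
proof -
  let ?R = "\<lambda>i. monom 1 i mod p"
  define D where "D = degree P"
  define C where "C = (\<Union>i<D. (range (coeff (?R i))))"
  have "finite (range (coeff r))" for r :: "rat poly"
  proof (rule finite_subset)
    have "coeff r i \<in> insert 0 (coeff r ` {..degree r})" for i
      by (cases "i \<le> degree r") (auto simp: coeff_eq_0)
    then show "range (coeff r) \<subseteq> insert 0 (coeff r ` {..degree r})"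
      by blast
  qed simp
  then have "finite C" by (auto simp: C_def)
  then obtain K where K: "K > 0" "\<And>a. a \<in> C \<Longrightarrow> of_int K * a \<in> \<int>"
    using common_denominator by blast
  have Pmod: "map_poly of_int P mod p = 0"
    using dvd by simp
  have mod_sum: "(\<Sum>i\<in>A. f i) mod p = (\<Sum>i\<in>A. f i mod p)" for A :: "nat set" and f
    by (induction A rule: infinite_finite_induct) (auto simp: poly_mod_add_left)
  have expand: "map_poly of_int q mod p = (\<Sum>i\<le>degree q. smult (of_int (coeff q i)) (?R i))"
    for q :: "int poly"
  proof -
    have "map_poly of_int q = (\<Sum>i\<le>degree q. smult (rat_of_int (coeff q i)) (monom 1 i))"
      by (subst poly_as_sum_of_monoms[symmetric]) (simp add: smult_monom)
    then show ?thesis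
      by (simp add: mod_sum mod_smult_left)
  qed
  have power: "of_int K * coeff (?R i) j \<in> \<int>" for i j
  proof (induction i arbitrary: j rule: less_induct)
    case (less i)
    show ?case
    proof (cases "i < D")
      case True
      then show ?thesis using K by (auto simp: C_def)
    next
      case False
      define e where "e = i - D"
      have i: "i = D + e" using False by (simp add: e_def)
      \<comment> \<open>Multiply the monic relation for \<open>x^D\<close> by \<open>x^e\<close> and reduce modulo \<open>p\<close>.\<close>
      have "map_poly of_int P = (\<Sum>k\<le>D. monom (rat_of_int (coeff P k)) k)"
        by (subst poly_as_sum_of_monoms[symmetric]) (simp add: D_def)
      also have "\<dots> = monom 1 D + (\<Sum>k<D. monom (rat_of_int (coeff P k)) k)"
        using monic by (simp add: D_def lessThan_Suc_atMost[symmetric])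
      finally have "map_poly of_int P * monom 1 e
          = monom 1 i + (\<Sum>k<D. smult (rat_of_int (coeff P k)) (monom 1 (k + e)))"
        by (simp add: i ring_distribs sum_distrib_right mult_monom smult_monom)
      then have "0 = (monom 1 i + (\<Sum>k<D. smult (rat_of_int (coeff P k)) (monom 1 (k + e)))) mod p"
        by (metis Pmod dvd dvd_mult2 mod_eq_0_iff_dvd)
      then have "0 = ?R i + (\<Sum>k<D. smult (rat_of_int (coeff P k)) (?R (k + e)))"
        by (simp add: poly_mod_add_left mod_sum mod_smult_left)
      then have "?R i = - (\<Sum>k<D. smult (rat_of_int (coeff P k)) (?R (k + e)))"
        by (metis add_eq_0_iff2)
      then have "of_int K * coeff (?R i) j
          = - (\<Sum>k<D. rat_of_int (coeff P k) * (of_int K * coeff (?R (k + e)) j))"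
        by (simp add: coeff_sum sum_distrib_left mult_ac)
      also have "\<dots> \<in> \<int>"
        by (intro Ints_minus Ints_sum, rule Ints_mult[OF Ints_of_int less.IH]) (auto simp: i)
      finally show ?thesis .
    qed
  qed
  show thesis
  proof (rule that[OF K(1)])
    fix q :: "int poly" and j
    have "of_int K * coeff (map_poly of_int q mod p) j
        = (\<Sum>i\<le>degree q. rat_of_int (coeff q i) * (of_int K * coeff (?R i) j))"
      by (simp add: expand coeff_sum sum_distrib_left mult_ac)
    also have "\<dots> \<in> \<int>"
      by (intro Ints_sum Ints_mult[OF Ints_of_int power])
    finally show "of_int K * coeff (map_poly of_int q mod p) j \<in> \<int>" .
  qed
qed

lemma finite_bounded_fractions:
  fixes K :: int and B :: real
  assumes "K > 0"
  shows "finite {a :: rat. of_int K * a \<in> \<int> \<and> \<bar>of_rat a\<bar> \<le> B}"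
proof (rule finite_subset)
  define N where "N = \<lceil>K * B\<rceil>"
  show "{a :: rat. of_int K * a \<in> \<int> \<and> \<bar>of_rat a\<bar> \<le> B} \<subseteq> (\<lambda>n. of_int n / of_int K) ` {-N..N}"
  proof
    fix a :: rat assume "a \<in> {a. of_int K * a \<in> \<int> \<and> \<bar>of_rat a\<bar> \<le> B}"
    then obtain n where n: "of_int K * a = of_int n" and B: "\<bar>of_rat a\<bar> \<le> B"
      by (auto elim: Ints_cases)
    have a: "a = of_int n / of_int K"
      using n assms by (simp add: field_simps)
    have "\<bar>real_of_int n\<bar> \<le> K * B"
      using B assms by (simp add: a of_rat_divide field_simps abs_divide)
    then have "\<bar>n\<bar> \<le> N"
      unfolding N_def by linarith
    then show "a \<in> (\<lambda>n. of_int n / of_int K) ` {-N..N}"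
      using a by (intro image_eqI[of _ _ n]) auto
  qed
qed simp

text \<open>
  Write \<open>q(\<alpha>) = r(\<alpha>)\<close> with \<open>r\<close> the remainder of \<open>q\<close> modulo the minimal polynomial of degree \<open>d\<close>. Since
  \<open>r\<close> and \<open>q\<close> agree at the \<open>d\<close> distinct conjugates and \<open>r\<close> has degree below \<open>d\<close>, interpolation
  bounds the coefficients of \<open>r\<close>. They also have a common denominator that does not depend on \<open>q\<close>, so
  there are only finitely many choices for them.
\<close>

theorem finite_bounded_conjugates:
  fixes \<alpha> :: complex and C :: "complex \<Rightarrow> real"
  assumes "algebraic_int \<alpha>"
  shows "finite {ipoly q \<alpha> | q. \<forall>z. galois_conjugate \<alpha> z \<longrightarrow> cmod (ipoly q z) \<le> C z}"
proof -
  obtain p where min: "is_min_poly p \<alpha>"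
    using assms algebraic_int_min_poly by blast
  then have irr: "irreducible p" and root: "rpoly p \<alpha> = 0"
    by (auto simp: is_min_poly_def)
  then have p: "p \<noteq> 0" "degree p > 0"
    by (auto simp: irreducible_def is_unit_iff_degree)
  define A where "A = {z :: complex. rpoly p z = 0}"
  have card: "card A = degree p"
    using card_roots_irreducible_rat_poly irr by (simp add: A_def)
  then have "finite A"
    using p by (metis card.infinite less_irrefl)
  obtain P where P: "ipoly P \<alpha> = 0" "lead_coeff P = 1"
    using assms unfolding algebraic_int_altdef_ipoly by blast
  have "p dvd map_poly of_int P"
    using irreducible_rat_poly_dvd_if_common_root[OF irr root] P(1) by (simp add: rpoly_of_int_poly)
  then obtain K where K: "K > 0" "\<And>q :: int poly. \<And>j. of_int K * coeff (map_poly of_int q mod p) j \<in> \<int>"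
    using integer_poly_mod_bounded_denominator P(2) by metis
  obtain L where L: "\<And>r. degree r < card A \<Longrightarrow> r = (\<Sum>z\<in>A. smult (poly r z) (L z))"
    using lagrange_interpolation \<open>finite A\<close> by blast
  define B where "B j = (\<Sum>z\<in>A. C z * cmod (coeff (L z) j))" for j
  define S where "S j = {a :: rat. of_int K * a \<in> \<int> \<and> \<bar>of_rat a\<bar> \<le> B j}" for j
  define d where "d = degree p"
  show ?thesis
  proof (rule finite_subset)
    show "{ipoly q \<alpha> | q. \<forall>z. galois_conjugate \<alpha> z \<longrightarrow> cmod (ipoly q z) \<le> C z}
        \<subseteq> (\<lambda>f. \<Sum>j<d. of_rat (f j) * \<alpha> ^ j) ` (\<Pi>\<^sub>E j\<in>{..<d}. S j)"
    proof safe
      fix q assume bound: "\<forall>z. galois_conjugate \<alpha> z \<longrightarrow> cmod (ipoly q z) \<le> C z"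
      define r where "r = map_poly of_int q mod p"
      let ?r = "map_poly of_rat r :: complex poly"
      have deg: "degree r < d"
        using p degree_mod_less'[of p] unfolding r_def d_def by (metis degree_0 degree_mod_less)
      obtain g where "map_poly of_int q = g * p + r"
        by (metis r_def div_mult_mod_eq)
      then have "rpoly (map_poly of_int q) z = rpoly (g * p + r) z" for z :: complex
        by simp
      then have r: "poly ?r z = ipoly q z" if "z \<in> A" for z
        using that by (simp add: A_def rat_poly.hom_add rat_poly.hom_mult rpoly_of_int_poly)
      have "coeff r j \<in> S j" for j
      proof -
        have "?r = (\<Sum>z\<in>A. smult (poly ?r z) (L z))"
          using deg by (intro L) (simp add: card d_def)
        then have "of_rat (coeff r j) = coeff (\<Sum>z\<in>A. smult (poly ?r z) (L z)) j"
          by (metis of_rat_hom.coeff_map_poly_hom)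
        also have "\<dots> = (\<Sum>z\<in>A. ipoly q z * coeff (L z) j)"
          by (simp add: coeff_sum r)
        finally have "cmod (of_rat (coeff r j)) = cmod (\<Sum>z\<in>A. ipoly q z * coeff (L z) j)"
          by (rule arg_cong)
        also have "\<dots> \<le> (\<Sum>z\<in>A. cmod (ipoly q z) * cmod (coeff (L z) j))"
          by (rule order_trans[OF norm_sum]) (simp add: norm_mult)
        also have "\<dots> \<le> B j"
          unfolding B_def using bound min
          by (intro sum_mono mult_right_mono) (auto simp: A_def galois_conjugate_def)
        finally have "\<bar>of_rat (coeff r j)\<bar> \<le> B j"
          by (simp only: cmod_of_rat)
        then show ?thesis
          using K(2) by (simp add: S_def r_def)
      qed
      moreover have "ipoly q \<alpha> = (\<Sum>j<d. of_rat (coeff r j) * \<alpha> ^ j)"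
      proof -
        have "ipoly q \<alpha> = poly ?r \<alpha>"
          using r root by (simp add: A_def)
        also have "\<dots> = (\<Sum>j\<le>degree r. of_rat (coeff r j) * \<alpha> ^ j)"
          by (simp add: poly_altdef)
        also have "\<dots> = (\<Sum>j<d. of_rat (coeff r j) * \<alpha> ^ j)"
          using deg by (intro sum.mono_neutral_left) (auto simp: coeff_eq_0)
        finally show ?thesis .
      qed
      ultimately show "ipoly q \<alpha> \<in> (\<lambda>f. \<Sum>j<d. of_rat (f j) * \<alpha> ^ j) ` (\<Pi>\<^sub>E j\<in>{..<d}. S j)"
        by (intro image_eqI[of _ _ "restrict (coeff r) {..<d}"]) auto
    qed
    show "finite ((\<lambda>f. \<Sum>j<d. of_rat (f j) * \<alpha> ^ j) ` (\<Pi>\<^sub>E j\<in>{..<d}. S j))"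
      using K(1) by (intro finite_imageI finite_PiE) (simp_all only: S_def finite_bounded_fractions finite_lessThan)
  qed
qed

section \<open>Differences of elements of X\<close>

lemma beta_sum_0: "beta_sum \<beta> 0 c = 0"
  by (simp add: beta_sum_def)

lemma beta_sum_Suc: "beta_sum \<beta> (Suc n) c = \<beta> * beta_sum \<beta> n c + of_int (c (Suc n))"
proof -
  have "(\<Sum>i = 1..n. of_int (c i) * \<beta> ^ (Suc n - i)) = \<beta> * beta_sum \<beta> n c"
    unfolding beta_sum_def sum_distrib_left
    by (intro sum.cong) (auto simp: Suc_diff_le)
  then show ?thesis
    by (simp add: beta_sum_def)
qed

lemma beta_sum_cong:
  assumes "\<And>i. i \<in> {1..n} \<Longrightarrow> c i = d i"
  shows "beta_sum \<beta> n c = beta_sum \<beta> n d"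
  unfolding beta_sum_def using assms by (intro sum.cong) auto

lemma beta_sum_in_X:
  assumes "\<And>i. i \<in> {1..n} \<Longrightarrow> c i \<in> {-1, 0, 1}"
  shows "beta_sum \<beta> n c \<in> X \<beta>"
  unfolding X_def using assms by blast

lemma beta_sum_eq_ipoly:
  assumes "\<And>i. i \<in> {1..n} \<Longrightarrow> \<bar>c i\<bar> \<le> 1"
  shows "\<exists>q. (\<forall>i. \<bar>coeff q i\<bar> \<le> 1) \<and> beta_sum \<beta> n c = ipoly q \<beta>"
  using assms
proof (induction n)
  case 0
  show ?case by (rule exI[of _ 0]) (simp add: beta_sum_0)
next
  case (Suc n)
  then obtain q where q: "\<forall>i. \<bar>coeff q i\<bar> \<le> 1" "beta_sum \<beta> n c = ipoly q \<beta>"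
    by force
  show ?case
    by (rule exI[of _ "pCons (c (Suc n)) q"])
      (use q Suc.prems in \<open>auto simp: beta_sum_Suc ipoly_pCons coeff_pCons split: nat.split\<close>)
qed

lemma X_diff_eq_ipoly:
  assumes "x \<in> X \<beta>" "y \<in> X \<beta>"
  obtains q where "\<And>i. \<bar>coeff q i\<bar> \<le> 2" "y - x = ipoly q \<beta>"
proof -
  have repr: "\<exists>q. (\<forall>i. \<bar>coeff q i\<bar> \<le> 1) \<and> u = ipoly q \<beta>" if "u \<in> X \<beta>" for u
  proof -
    obtain n c where u: "u = beta_sum \<beta> n c" and c: "\<forall>i\<in>{1..n}. c i \<in> {-1, 0, 1}"
      using \<open>u \<in> X \<beta>\<close> unfolding X_def by blast
    have "\<bar>c i\<bar> \<le> 1" if "i \<in> {1..n}" for i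
      using bspec[OF c that] by auto
    then show ?thesis
      unfolding u by (rule beta_sum_eq_ipoly)
  qed
  obtain p where p: "\<forall>i. \<bar>coeff p i\<bar> \<le> 1" "x = ipoly p \<beta>"
    using repr[OF assms(1)] by blast
  obtain q where q: "\<forall>i. \<bar>coeff q i\<bar> \<le> 1" "y = ipoly q \<beta>"
    using repr[OF assms(2)] by blast
  show thesis
  proof (rule that[of "q - p"])
    show "\<bar>coeff (q - p) i\<bar> \<le> 2" for i
      using spec[OF p(1), of i] spec[OF q(1), of i] by simp
    show "y - x = ipoly (q - p) \<beta>"
      by (simp add: p q of_int_poly_hom.hom_minus)
  qed
qed

text \<open>
  The bound is the geometric series; it satisfies \<open>C = B + |z| C\<close>, which is the induction step.
\<close>

lemma cmod_ipoly_le: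
  assumes "cmod z < 1" "\<And>i. \<bar>coeff q i\<bar> \<le> B"
  shows "cmod (ipoly q z) \<le> B / (1 - cmod z)"
  using assms(2)
proof (induction q)
  case 0
  from this[of 0] show ?case using assms(1) by simp
next
  case (pCons a q)
  have a: "\<bar>a\<bar> \<le> B" and q: "\<bar>coeff q i\<bar> \<le> B" for i
    using pCons.prems[of 0] pCons.prems[of "Suc i"] by auto
  have "cmod (ipoly (pCons a q) z) \<le> cmod (of_int a) + cmod z * cmod (ipoly q z)"
    by (simp only: ipoly_pCons norm_mult[symmetric] norm_triangle_ineq)
  also have "\<dots> \<le> B + cmod z * (B / (1 - cmod z))"
    using a pCons.IH[OF q] by (intro add_mono mult_left_mono) auto
  also have "\<dots> = B / (1 - cmod z)"
    using assms(1) by (simp add: field_simps)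
  finally show ?case .
qed

lemma galois_conjugate_ipoly_eq_0:
  assumes "galois_conjugate \<alpha> z" "ipoly q \<alpha> = 0"
  shows "ipoly q z = 0"
proof -
  obtain p where p: "irreducible p" "rpoly p \<alpha> = 0" "rpoly p z = 0"
    using assms(1) by (auto simp: galois_conjugate_def is_min_poly_def)
  then obtain g where "map_poly of_int q = p * g"
    using irreducible_rat_poly_dvd_if_common_root[of p \<alpha> "map_poly of_int q"] assms(2)
    by (auto simp: rpoly_of_int_poly)
  then have "rpoly (map_poly of_int q) z = rpoly (p * g) z"
    by simp
  then show ?thesis
    using p(3) by (simp add: rpoly_of_int_poly hom_distribs)
qed

section \<open>The finite set of offsets\<close>

text \<open>
  The bound \<open>C = 2 / \<bar>|z| - 1\<bar>\<close> is the fixed point of \<open>C = 2 + |z| C\<close> for \<open>|z| < 1\<close> and of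
  \<open>C = (C + 2) / |z|\<close> for \<open>|z| > 1\<close>. Quantifying over polynomials \<open>q\<close> makes the conjugates
  \<open>q(z)\<close> of \<open>q(\<beta>)\<close> available without field embeddings; they do not depend on the choice of \<open>q\<close> by
  \<open>galois_conjugate_ipoly_eq_0\<close>.
\<close>

definition offsets :: "real \<Rightarrow> real set" where
  "offsets \<beta> = {ipoly q \<beta> | q. \<forall>z. galois_conjugate (of_real \<beta>) z \<longrightarrow>
     cmod (ipoly q z) \<le> 2 / \<bar>cmod z - 1\<bar>}"

lemma finite_offsets:
  assumes "algebraic_int \<beta>"
  shows "finite (offsets \<beta>)"
proof -
  have "complex_of_real ` offsets \<beta> \<subseteq> {ipoly q (complex_of_real \<beta>) | q.
      \<forall>z. galois_conjugate (of_real \<beta>) z \<longrightarrow> cmod (ipoly q z) \<le> 2 / \<bar>cmod z - 1\<bar>}"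
    by (auto simp: offsets_def ipoly_of_real)
  then have "finite (complex_of_real ` offsets \<beta>)"
    using finite_bounded_conjugates[of "complex_of_real \<beta>"] assms
    by (meson algebraic_int_of_real finite_subset)
  then show ?thesis
    by (rule finite_imageD) (simp add: inj_on_def)
qed

lemma zero_in_offsets: "0 \<in> offsets \<beta>"
  unfolding offsets_def by (auto intro!: exI[of _ 0])

text \<open>
  In the recursion, \<open>u = d - (e - f)\<close> for an appended letter \<open>d\<close> and a removed pair of letters \<open>(e, f)\<close>.
  The hypothesis that \<open>x\<close> and \<open>x + (t + u) / \<beta>\<close> lie in \<open>X \<beta>\<close> bounds the conjugates inside the unit
  circle and shows that division by \<open>\<beta>\<close> has not led out of \<open>\<int>[\<beta>]\<close>. The bound at the
  conjugates outside is inherited from \<open>t\<close>.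
\<close>

lemma offsets_step:
  assumes hyp: "hyperbolic \<beta>" and t: "t \<in> offsets \<beta>" and u: "\<bar>u\<bar> \<le> 2"
    and x: "x \<in> X \<beta>" "x + (t + of_int u) / \<beta> \<in> X \<beta>"
  shows "(t + of_int u) / \<beta> \<in> offsets \<beta>"
proof -
  define s where "s = (t + of_int u) / \<beta>"
  have "\<beta> > 1" using hyp by (simp add: hyperbolic_def)
  obtain q where q: "t = ipoly q \<beta>"
      "\<And>z. galois_conjugate (of_real \<beta>) z \<Longrightarrow> cmod (ipoly q z) \<le> 2 / \<bar>cmod z - 1\<bar>"
    using t by (auto simp: offsets_def)
  obtain r where r: "\<And>i. \<bar>coeff r i\<bar> \<le> 2" "s = ipoly r \<beta>"
    using X_diff_eq_ipoly[OF x] by (auto simp: s_def)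
  have "cmod (ipoly r z) \<le> 2 / \<bar>cmod z - 1\<bar>" if z: "galois_conjugate (of_real \<beta>) z" for z
  proof (cases "cmod z < 1")
    case True
    then show ?thesis
      using cmod_ipoly_le[of z r 2] r(1) by simp
  next
    case False
    with hyp z have z1: "cmod z > 1"
      by (force simp: hyperbolic_def)
    \<comment> \<open>The relation \<open>\<beta> s = t + u\<close> between polynomials in \<open>\<beta>\<close> carries over to the conjugate \<open>z\<close>.\<close>
    have "ipoly (pCons (- u) r - q) \<beta> = 0"
      using \<open>\<beta> > 1\<close> by (simp add: hom_distribs ipoly_pCons flip: r(2) q(1)) (simp add: s_def)
    then have "ipoly (pCons (- u) r - q) z = 0"
      using galois_conjugate_ipoly_eq_0[OF z] by (simp add: ipoly_of_real)
    then have "z * ipoly r z = ipoly q z + of_int u"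
      by (simp add: hom_distribs ipoly_pCons algebra_simps)
    then have "cmod z * cmod (ipoly r z) \<le> cmod (ipoly q z) + cmod (of_int u)"
      by (metis norm_mult norm_triangle_ineq)
    also have "\<dots> \<le> 2 / (cmod z - 1) + 2"
      using q(2)[OF z] z1 u by (intro add_mono) auto
    also have "\<dots> = cmod z * (2 / (cmod z - 1))"
      using z1 by (simp add: field_simps)
    finally have "cmod (ipoly r z) \<le> 2 / (cmod z - 1)"
      using z1 by (simp only: mult_le_cancel_left_pos)
    then show ?thesis using z1 by simp
  qed
  then show ?thesis
    using r(2) unfolding offsets_def s_def by blast
qed

section \<open>The recursion for the counts and for their limit\<close>

lemma count_Suc:
  assumes "\<beta> \<noteq> 0"
  shows "\<N> \<beta> (Suc n) y = (\<Sum>(e, f)\<in>{0, 1} \<times> {0, 1}. \<N> \<beta> n ((y - of_int (e - f)) / \<beta>))"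
proof -
  define B where "B n = ({1..n} \<rightarrow>\<^sub>E {0, 1} :: (nat \<Rightarrow> int) set)" for n
  define D where "D n y = {(a, b). a \<in> B n \<and> b \<in> B n \<and> beta_sum \<beta> n (\<lambda>i. a i - b i) = y}" for n y
  have N: "\<N> \<beta> n y = card (D n y)" for n y
    by (simp add: \<N>_def D_def B_def)
  have finB: "finite (B n)"
    by (auto simp: B_def intro!: finite_PiE)
  have fin: "finite (D n y)" for y
    by (rule finite_subset[of _ "B n \<times> B n"]) (use finB in \<open>auto simp: D_def\<close>)
  let ?S = "SIGMA ef:{0, 1} \<times> {0, 1}. D n ((y - of_int (fst ef - snd ef)) / \<beta>)"
  let ?ext = "\<lambda>((e, f), (a, b)). (a(Suc n := e), b(Suc n := f))"
  let ?cut = "\<lambda>(a, b). ((a (Suc n), b (Suc n)), (restrict a {1..n}, restrict b {1..n}))"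
  have Suc: "beta_sum \<beta> (Suc n) (\<lambda>i. a i - b i) = y \<longleftrightarrow>
      beta_sum \<beta> n (\<lambda>i. a i - b i) = (y - of_int (a (Suc n) - b (Suc n))) / \<beta>" for a b :: "nat \<Rightarrow> int"
    using assms by (auto simp: beta_sum_Suc field_simps)
  have ext_eq: "beta_sum \<beta> n (\<lambda>i. (a(Suc n := e)) i - (b(Suc n := f)) i) = beta_sum \<beta> n (\<lambda>i. a i - b i)"
    for a b :: "nat \<Rightarrow> int" and e f by (rule beta_sum_cong) auto
  have cut_eq: "beta_sum \<beta> n (\<lambda>i. restrict a {1..n} i - restrict b {1..n} i) = beta_sum \<beta> n (\<lambda>i. a i - b i)"
    for a b :: "nat \<Rightarrow> int" by (rule beta_sum_cong) auto
  have ext_B: "a(Suc n := e) \<in> B (Suc n)" if "a \<in> B n" "e \<in> {0, 1}" for a e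
    using that unfolding B_def by (auto simp: PiE_iff extensional_def)
  have cut_B: "restrict a {1..n} \<in> B n" "a (Suc n) \<in> {0, 1}" if "a \<in> B (Suc n)" for a
    using that unfolding B_def by (auto simp: PiE_iff)
  have restrict_B: "restrict a {Suc 0..n} = a" if "a \<in> B n" for a
    using that unfolding B_def by (simp add: PiE_restrict)
  have ext_cut: "(restrict a {1..n})(Suc n := a (Suc n)) = a" if "a \<in> B (Suc n)" for a
    using that unfolding B_def by (auto simp: PiE_iff extensional_def fun_eq_iff)
  have "bij_betw ?ext ?S (D (Suc n) y)"
  proof (rule bij_betw_byWitness[where f' = ?cut])
    show "\<forall>p\<in>?S. ?cut (?ext p) = p"
      by (clarsimp simp: D_def restrict_B)
    show "\<forall>p\<in>D (Suc n) y. ?ext (?cut p) = p"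
    proof
      fix p assume "p \<in> D (Suc n) y"
      then obtain a b where "p = (a, b)" "a \<in> B (Suc n)" "b \<in> B (Suc n)"
        unfolding D_def by blast
      then show "?ext (?cut p) = p"
        by (simp only: prod.case ext_cut)
    qed
    show "?ext ` ?S \<subseteq> D (Suc n) y"
    proof
      fix p assume "p \<in> ?ext ` ?S"
      then obtain e f a b where p: "p = (a(Suc n := e), b(Suc n := f))"
        and ef: "e \<in> {0, 1}" "f \<in> {0, 1}"
        and D: "(a, b) \<in> D n ((y - of_int (e - f)) / \<beta>)"
        by auto
      have "beta_sum \<beta> (Suc n) (\<lambda>i. (a(Suc n := e)) i - (b(Suc n := f)) i) = y"
        using D by (simp only: Suc ext_eq fun_upd_same) (simp add: D_def)
      then show "p \<in> D (Suc n) y"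
        using D ef ext_B unfolding D_def p by blast
    qed
    show "?cut ` D (Suc n) y \<subseteq> ?S"
    proof
      fix p assume "p \<in> ?cut ` D (Suc n) y"
      then obtain a b where p: "p = ((a (Suc n), b (Suc n)), (restrict a {1..n}, restrict b {1..n}))"
        and D: "(a, b) \<in> D (Suc n) y"
        by auto
      have "beta_sum \<beta> n (\<lambda>i. restrict a {1..n} i - restrict b {1..n} i)
          = (y - of_int (a (Suc n) - b (Suc n))) / \<beta>"
        using D by (simp only: cut_eq) (simp add: D_def Suc)
      then have "(restrict a {1..n}, restrict b {1..n}) \<in> D n ((y - of_int (a (Suc n) - b (Suc n))) / \<beta>)"
        using D cut_B(1) unfolding D_def by blast
      moreover have "a (Suc n) \<in> {0, 1}" "b (Suc n) \<in> {0, 1}"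
        using D cut_B(2) unfolding D_def by blast+
      ultimately show "p \<in> ?S"
        unfolding p by (intro SigmaI) (simp_all only: fst_conv snd_conv)
    qed
  qed
  then have "card (D (Suc n) y) = card ?S"
    by (simp only: bij_betw_same_card)
  also have "\<dots> = (\<Sum>(e, f)\<in>{0, 1} \<times> {0, 1}. card (D n ((y - of_int (e - f)) / \<beta>)))"
    using fin by (subst card_SigmaI) (auto simp only: finite.intros finite_cartesian_product case_prod_unfold)
  finally show ?thesis
    by (simp only: N)
qed

lemma count_eq_0_outside_X:
  assumes "y \<notin> X \<beta>"
  shows "\<N> \<beta> n y = 0"
proof -
  have "beta_sum \<beta> n (\<lambda>i. a i - b i) \<noteq> y"
    if a: "a \<in> {1..n} \<rightarrow>\<^sub>E {0, 1}" and b: "b \<in> {1..n} \<rightarrow>\<^sub>E {0, 1}" for a b :: "nat \<Rightarrow> int"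
  proof -
    have "a i - b i \<in> {-1, 0, 1}" if "i \<in> {1..n}" for i
      using PiE_mem[OF a that] PiE_mem[OF b that] by auto
    then have "beta_sum \<beta> n (\<lambda>i. a i - b i) \<in> X \<beta>"
      by (rule beta_sum_in_X)
    then show ?thesis
      using assms by auto
  qed
  then have "{(a, b). a \<in> {1..n} \<rightarrow>\<^sub>E {0, 1} \<and> b \<in> {1..n} \<rightarrow>\<^sub>E {0, 1} \<and>
      beta_sum \<beta> n (\<lambda>i. a i - b i) = y} = {}"
    by blast
  then show ?thesis
    by (simp only: \<N>_def card.empty)
qed

lemma mu_eq_0_outside_X:
  assumes "y \<notin> X \<beta>"
  shows "\<mu> \<beta> l y = 0"
  using assms by (simp add: \<mu>_def count_eq_0_outside_X limI)

lemma mu_tendsto: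
  assumes "growth_rate \<beta> l"
  shows "(\<lambda>n. real (\<N> \<beta> n y) / l ^ n) \<longlonglongrightarrow> \<mu> \<beta> l y"
proof (cases "y \<in> X \<beta>")
  case True
  then show ?thesis
    using assms unfolding growth_rate_def \<mu>_def by (metis limI)
next
  case False
  then show ?thesis
    by (simp add: count_eq_0_outside_X mu_eq_0_outside_X)
qed

text \<open>
  The recursion for the counts survives in the limit, since each of its four terms converges; the
  factor \<open>l\<close> comes from comparing words of length \<open>n + 1\<close> with words of length \<open>n\<close>.
\<close>

lemma mu_recursion:
  assumes "growth_rate \<beta> l" "\<beta> \<noteq> 0"
  shows "l * \<mu> \<beta> l y = (\<Sum>(e, f)\<in>{0, 1} \<times> {0, 1}. \<mu> \<beta> l ((y - of_int (e - f)) / \<beta>))"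
proof (rule LIMSEQ_unique)
  have "l \<noteq> 0" using assms(1) by (simp add: growth_rate_def)
  show "(\<lambda>n. l * (real (\<N> \<beta> (Suc n) y) / l ^ Suc n)) \<longlonglongrightarrow> l * \<mu> \<beta> l y"
    by (intro tendsto_mult_left LIMSEQ_Suc mu_tendsto assms)
  have "(\<lambda>n. \<Sum>ef\<in>{0, 1} \<times> {0, 1}. real (\<N> \<beta> n ((y - of_int (fst ef - snd ef)) / \<beta>)) / l ^ n)
      \<longlonglongrightarrow> (\<Sum>ef\<in>{0, 1} \<times> {0, 1}. \<mu> \<beta> l ((y - of_int (fst ef - snd ef)) / \<beta>))"
    by (intro tendsto_sum mu_tendsto assms)
  moreover have "l * (real (\<N> \<beta> (Suc n) y) / l ^ Suc n)
      = (\<Sum>ef\<in>{0, 1} \<times> {0, 1}. real (\<N> \<beta> n ((y - of_int (fst ef - snd ef)) / \<beta>)) / l ^ n)" for n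
    using \<open>l \<noteq> 0\<close>
    by (simp only: count_Suc[OF assms(2)] sum_divide_distrib[symmetric] of_nat_sum case_prod_unfold) simp
  ultimately show "(\<lambda>n. l * (real (\<N> \<beta> (Suc n) y) / l ^ Suc n)) \<longlonglongrightarrow>
      (\<Sum>(e, f)\<in>{0, 1} \<times> {0, 1}. \<mu> \<beta> l ((y - of_int (e - f)) / \<beta>))"
    by (simp only: case_prod_unfold)
qed

section \<open>The matrix representation\<close>

lemma row_product_0: "row_product W M 0 c = W"
  by (simp add: row_product_def)

lemma row_product_Suc: "row_product W M (Suc n) c = row_product W M n c * M (c (Suc n))"
  by (simp add: row_product_def)

theorem theorem1p2:
  fixes \<beta> l :: real
  assumes "hyperbolic \<beta>"
    and "growth_rate \<beta> l"
  shows "\<exists>(k :: nat) (W :: real mat) (M :: int \<Rightarrow> real mat).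
    k \<ge> 1 \<and> W \<in> carrier_mat 1 k \<and> (\<forall>d\<in>{-1, 0, 1}. M d \<in> carrier_mat k k) \<and>
    (\<forall>x\<in>X \<beta>. \<forall>n c. (\<forall>i\<in>{1..n}. c i \<in> {-1, 0, 1}) \<longrightarrow> x = beta_sum \<beta> n c \<longrightarrow>
       \<mu> \<beta> l x = 1 / l ^ n * (row_product W M n c $$ (0, 0)))"
proof -
  have \<beta>: "\<beta> > 1" "algebraic_int \<beta>" and l: "l > 1"
    using assms by (auto simp: hyperbolic_def growth_rate_def)
  obtain ts' where ts': "set ts' = offsets \<beta> - {0}" "distinct ts'"
    using finite_distinct_list finite_offsets[OF \<beta>(2)] by (metis finite_Diff)
  \<comment> \<open>The offset 0 comes first, so that the first entry of the row vector is \<open>\<mu>\<close> at the point itself.\<close>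
  define ts where "ts = 0 # ts'"
  define k where "k = length ts"
  have ts: "set ts = offsets \<beta>" "distinct ts" "ts ! 0 = 0" "k \<ge> 1"
    using ts' zero_in_offsets by (auto simp: ts_def k_def)
  \<comment> \<open>Four pairs \<open>(e, f)\<close> are summed over; pairs leading to the same offset add up in one matrix entry.\<close>
  define W where "W = mat 1 k (\<lambda>(_, j). \<mu> \<beta> l (ts ! j))"
  define M where "M d = mat k k (\<lambda>(i, j). \<Sum>(e, f)\<in>{0, 1} \<times> {0, 1}.
    if ts ! i = (ts ! j + of_int (d - (e - f))) / \<beta> then 1 else 0 :: real)" for d
  have M_dim: "dim_row (M d) = k" "dim_col (M d) = k" for d
    by (simp_all add: M_def)
  \<comment> \<open>An offset missing from the list does no harm, as it leads out of \<open>X \<beta>\<close>, where \<open>\<mu>\<close> vanishes.\<close>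
  have select: "(\<Sum>i<k. \<mu> \<beta> l (x + ts ! i) * (if ts ! i = s then 1 else 0)) = \<mu> \<beta> l (x + s)"
    if "s \<in> offsets \<beta> \<or> x + s \<notin> X \<beta>" for x s
  proof -
    have "(\<Sum>i<k. \<mu> \<beta> l (x + ts ! i) * (if ts ! i = s then 1 else 0))
        = (\<Sum>t\<in>offsets \<beta>. \<mu> \<beta> l (x + t) * (if t = s then 1 else 0))"
      using ts by (intro sum.reindex_bij_betw[OF bij_betw_nth]) (auto simp: k_def)
    also have "\<dots> = (\<Sum>t\<in>offsets \<beta>. if t = s then \<mu> \<beta> l (x + s) else 0)"
      by (intro sum.cong) auto
    also have "\<dots> = \<mu> \<beta> l (x + s)"
      using that finite_offsets[OF \<beta>(2)] by (auto simp: mu_eq_0_outside_X)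
    finally show ?thesis .
  qed
  have product: "row_product W M n c = mat 1 k (\<lambda>(_, j). l ^ n * \<mu> \<beta> l (beta_sum \<beta> n c + ts ! j))"
    if "\<forall>i\<in>{1..n}. c i \<in> {-1, 0, 1}" for n c
    using that
  proof (induction n)
    case 0
    show ?case by (simp add: row_product_0 W_def beta_sum_0)
  next
    case (Suc n)
    define x d where "x = beta_sum \<beta> n c" and "d = c (Suc n)"
    have d: "d \<in> {-1, 0, 1}"
      using bspec[OF Suc.prems, of "Suc n"] by (simp add: d_def)
    have x: "x \<in> X \<beta>"
      unfolding x_def by (rule beta_sum_in_X) (use Suc.prems in simp)
    have IH: "row_product W M n c = mat 1 k (\<lambda>(_, j). l ^ n * \<mu> \<beta> l (x + ts ! j))"
      using Suc by (simp add: x_def)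
    have entry: "(\<Sum>i<k. \<mu> \<beta> l (x + ts ! i) * M d $$ (i, j)) = l * \<mu> \<beta> l (\<beta> * x + of_int d + ts ! j)"
      if "j < k" for j
    proof -
      let ?s = "\<lambda>ef. (ts ! j + of_int (d - (fst ef - snd ef))) / \<beta>"
      have s: "?s ef \<in> offsets \<beta> \<or> x + ?s ef \<notin> X \<beta>" if "ef \<in> {0, 1} \<times> {0, 1}" for ef
      proof -
        have "ts ! j \<in> offsets \<beta>"
          using nth_mem[of j ts] \<open>j < k\<close> by (simp only: k_def ts(1))
        moreover have "\<bar>d - (fst ef - snd ef)\<bar> \<le> 2"
          using d that by auto
        ultimately show ?thesis
          using offsets_step[OF assms(1)] x by blast
      qed
      have "(\<Sum>i<k. \<mu> \<beta> l (x + ts ! i) * M d $$ (i, j))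
          = (\<Sum>i<k. \<Sum>ef\<in>{0, 1} \<times> {0, 1}. \<mu> \<beta> l (x + ts ! i) * (if ts ! i = ?s ef then 1 else 0))"
        using that unfolding sum_distrib_left[symmetric]
        by (intro sum.cong refl) (simp add: M_def case_prod_unfold)
      also have "\<dots> = (\<Sum>ef\<in>{0, 1} \<times> {0, 1}. \<mu> \<beta> l (x + ?s ef))"
        by (subst sum.swap) (intro sum.cong refl select s)
      also have "\<dots> = (\<Sum>ef\<in>{0, 1} \<times> {0, 1}.
          \<mu> \<beta> l ((\<beta> * x + of_int d + ts ! j - of_int (fst ef - snd ef)) / \<beta>))"
        using \<beta>(1) by (intro sum.cong refl arg_cong[where f = "\<mu> \<beta> l"]) (simp add: field_simps)
      also have "\<dots> = l * \<mu> \<beta> l (\<beta> * x + of_int d + ts ! j)"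
        using mu_recursion[OF assms(2)] \<beta>(1) by (simp add: case_prod_unfold)
      finally show ?thesis .
    qed
    show ?case
    proof (rule eq_matI)
      fix i j assume ij: "i < dim_row (mat 1 k (\<lambda>(_, j). l ^ Suc n * \<mu> \<beta> l (beta_sum \<beta> (Suc n) c + ts ! j)))"
        "j < dim_col (mat 1 k (\<lambda>(_, j). l ^ Suc n * \<mu> \<beta> l (beta_sum \<beta> (Suc n) c + ts ! j)))"
      then have "row_product W M (Suc n) c $$ (i, j)
          = (\<Sum>m<k. l ^ n * \<mu> \<beta> l (x + ts ! m) * M d $$ (m, j))"
        by (simp add: row_product_Suc IH scalar_prod_def M_dim d_def[symmetric] lessThan_atLeast0)
      also have "\<dots> = l ^ n * (\<Sum>m<k. \<mu> \<beta> l (x + ts ! m) * M d $$ (m, j))"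
        by (simp add: sum_distrib_left mult.assoc)
      also have "\<dots> = l ^ n * (l * \<mu> \<beta> l (\<beta> * x + of_int d + ts ! j))"
        using entry ij by simp
      finally show "row_product W M (Suc n) c $$ (i, j)
          = mat 1 k (\<lambda>(_, j). l ^ Suc n * \<mu> \<beta> l (beta_sum \<beta> (Suc n) c + ts ! j)) $$ (i, j)"
        using ij by (simp add: beta_sum_Suc x_def d_def)
    qed (simp_all add: row_product_Suc IH M_dim)
  qed
  show ?thesis
  proof (intro exI conjI ballI allI impI)
    show "k \<ge> 1" by (rule ts(4))
    show "W \<in> carrier_mat 1 k" by (simp add: W_def)
    show "M d \<in> carrier_mat k k" for d by (simp add: M_def)
    fix x n c assume "\<forall>i\<in>{1..n}. c i \<in> {-1, 0, 1}" "x = beta_sum \<beta> n c"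
    then show "\<mu> \<beta> l x = 1 / l ^ n * (row_product W M n c $$ (0, 0))"
      using product[of n c] ts(3,4) l by simp
  qed
qed

end
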